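(* Let $c$ be a positive constant. The two-component Hunter--Saxton (2-HS) equation $$\left\{\begin{array}{l}u_{tx}-uu_{xx}-\dfrac12 u_x^2-4u-\dfrac{c^2}{2}\rho^2+\dfrac{c^2}{2}=0,\\[2mm] \rho_t=(\rho u)_x,\end{array}\right.$$ for the functions $u=u(x,t)$ and $\rho=\rho(x,t)$, is derived from the set of bilinear equations $$\left\{\begin{array}{l}(D_T^2+cD_T)\,g\cdot f=0,\\[1mm] \bigl(D_X(D_T^2+cD_T)-4D_T\bigr)\,g\cdot f=0,\end{array}\right.$$ for the functions $f=f(X,T)$ and $g=g(X,T)$, through the hodograph transformation $$dX=\rho\,dx+\rho u\,dt,\qquad dT=dt,$$ and the dependent variable transformation $$\psi=\frac{g}{f},\qquad u=(\log f)_{TT},\qquad \rho=\frac{1}{1-(\log f)_{XT}}.$$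
   Context: Hirota bilinear operators: for functions $g,f$ of $(X,T)$, $$D_X^lD_T^m\,g\cdot f=\left.(\partial_X-\partial_{X'})^l(\partial_T-\partial_{T'})^m\,g(X,T)f(X',T')\right|_{X'=X,\,T'=T},$$ extended linearly to polynomials in $D_X,D_T$. Subscripts denote partial derivatives. The dependent variable transformation defines $\psi$, $u$ and $\rho$ as functions of $(X,T)$ from $f$ and $g$ (wherever these expressions make sense). The hodograph transformation changes the independent variables from $(X,T)$ to $(x,t)$; equivalently $dx=\rho^{-1}dX-u\,dT$, $dt=dT$, so that $\partial_X=\rho^{-1}\partial_x$ and $\partial_T=\partial_t-u\partial_x$. In the 2-HS equation, $u$ and $\rho$ are regarded as functions of $(x,t)$ via this change of variables.
   Formalization: The functions are real with f > 0, and ψ = g/f is additionally assumed not to vanish identically on any nonempty open set; without this the claim fails, since g = 0 solves the bilinear equations for every f. *)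

theory Defs
  imports "HOL-Analysis.Analysis"
begin

text \<open>Functions of \<open>(X, T)\<close> or \<open>(x, t)\<close> are functions on the plane \<^typ>\<open>real \<times> real\<close>; \<open>pd1\<close> and
  \<open>pd2\<close> are the partial derivatives in the first and the second coordinate.\<close>

definition pd1 :: "(real \<times> real \<Rightarrow> real) \<Rightarrow> real \<times> real \<Rightarrow> real" where
  "pd1 F p = deriv (\<lambda>s. F (s, snd p)) (fst p)"

definition pd2 :: "(real \<times> real \<Rightarrow> real) \<Rightarrow> real \<times> real \<Rightarrow> real" where
  "pd2 F p = deriv (\<lambda>s. F (fst p, s)) (snd p)"

text \<open>Functions of class \<open>C\<^sup>k\<close>; meant for open \<open>S\<close>, where it agrees with the usual notion.\<close>

fun Ck_on :: "nat \<Rightarrow> (real \<times> real) set \<Rightarrow> (real \<times> real \<Rightarrow> real) \<Rightarrow> bool" where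
  "Ck_on 0 S F \<longleftrightarrow> continuous_on S F"
| "Ck_on (Suc k) S F \<longleftrightarrow>
     (\<forall>p\<in>S. F differentiable (at p)) \<and> Ck_on k S (pd1 F) \<and> Ck_on k S (pd2 F)"

text \<open>Hirota operators. A function \<open>K p q\<close> of two points \<open>p = (X, T)\<close> and \<open>q = (X', T')\<close> is acted on
  by \<open>\<partial>\<^sub>X - \<partial>\<^sub>X'\<close> and \<open>\<partial>\<^sub>T - \<partial>\<^sub>T'\<close>; the result is then restricted to the diagonal.\<close>

type_synonym two_point = "real \<times> real \<Rightarrow> real \<times> real \<Rightarrow> real"

definition hirota_X :: "two_point \<Rightarrow> two_point" where
  "hirota_X K p q = pd1 (\<lambda>r. K r q) p - pd1 (\<lambda>r. K p r) q"

definition hirota_T :: "two_point \<Rightarrow> two_point" where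
  "hirota_T K p q = pd2 (\<lambda>r. K r q) p - pd2 (\<lambda>r. K p r) q"

text \<open>\<open>hirota l m g f p\<close> is the value of \<open>D\<^sub>X\<^sup>l D\<^sub>T\<^sup>m g \<cdot> f\<close> at \<open>p\<close>.\<close>

definition hirota ::
    "nat \<Rightarrow> nat \<Rightarrow> (real \<times> real \<Rightarrow> real) \<Rightarrow> (real \<times> real \<Rightarrow> real) \<Rightarrow> real \<times> real \<Rightarrow> real" where
  "hirota l m g f p = (hirota_X ^^ l) ((hirota_T ^^ m) (\<lambda>a b. g a * f b)) p p"

text \<open>The bilinear equations \<open>(D\<^sub>T\<^sup>2 + c D\<^sub>T) g \<cdot> f = 0\<close> and
  \<open>(D\<^sub>X (D\<^sub>T\<^sup>2 + c D\<^sub>T) - 4 D\<^sub>T) g \<cdot> f = 0\<close>, the operator polynomials being multiplied out.\<close>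

definition bilinear_eqs ::
    "real \<Rightarrow> (real \<times> real) set \<Rightarrow> (real \<times> real \<Rightarrow> real) \<Rightarrow> (real \<times> real \<Rightarrow> real) \<Rightarrow> bool" where
  "bilinear_eqs c U g f \<longleftrightarrow> (\<forall>p\<in>U.
     hirota 0 2 g f p + c * hirota 0 1 g f p = 0 \<and>
     hirota 1 2 g f p + c * hirota 1 1 g f p - 4 * hirota 0 1 g f p = 0)"

text \<open>Classical solutions \<open>(u, \<rho>)\<close> of the two-component Hunter--Saxton equation on an open set \<open>V\<close>
  of points \<open>(x, t)\<close>. The regularity clauses guarantee that every derivative in the
  equations exists.\<close>

definition two_HS ::
    "real \<Rightarrow> (real \<times> real) set \<Rightarrow> (real \<times> real \<Rightarrow> real) \<Rightarrow> (real \<times> real \<Rightarrow> real) \<Rightarrow> bool" where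
  "two_HS c V u \<rho> \<longleftrightarrow> Ck_on 2 V u \<and> Ck_on 1 V \<rho> \<and> (\<forall>p\<in>V.
     pd1 (pd2 u) p - u p * pd1 (pd1 u) p - 1/2 * (pd1 u p)\<^sup>2 - 4 * u p
       - c\<^sup>2 / 2 * (\<rho> p)\<^sup>2 + c\<^sup>2 / 2 = 0 \<and>
     pd2 \<rho> p = pd1 (\<lambda>q. \<rho> q * u q) p)"

text \<open>\<open>H\<close> expresses the old variables \<open>(X, T) \<in> U\<close> through the new variables \<open>(x, t) \<in> V\<close>, with
  \<open>dX = \<rho> dx + \<rho> u dt\<close> and \<open>dT = dt\<close>; here \<open>u\<close> and \<open>\<rho>\<close> are given as functions of \<open>(X, T)\<close>, and
  \<open>u \<circ> H\<close> and \<open>\<rho> \<circ> H\<close> are the same quantities as functions of \<open>(x, t)\<close>.\<close>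

definition hodograph ::
    "(real \<times> real \<Rightarrow> real) \<Rightarrow> (real \<times> real \<Rightarrow> real) \<Rightarrow> (real \<times> real) set \<Rightarrow> (real \<times> real) set
      \<Rightarrow> (real \<times> real \<Rightarrow> real \<times> real) \<Rightarrow> bool" where
  "hodograph u \<rho> V U H \<longleftrightarrow> open V \<and> open U \<and> bij_betw H V U \<and>
     (\<forall>p\<in>V. (H has_derivative
        (\<lambda>(dx, dt). (\<rho> (H p) * dx + \<rho> (H p) * u (H p) * dt, dt))) (at p))"

end

theory Submission
  imports Defs
begin

text \<open>Put \<open>\<phi> = log f\<close>, so that \<open>u = \<phi>\<^sub>T\<^sub>T\<close>, \<open>1 / \<rho> = 1 - \<phi>\<^sub>X\<^sub>T\<close> and hence \<open>\<rho>\<^sub>T = \<rho>\<^sup>2 u\<^sub>X\<close>, which is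
  the second 2-HS equation in the variables \<open>(X, T)\<close>. Divided by \<open>f\<^sup>2\<close>, the first bilinear equation reads
  \<open>\<psi>\<^sub>T\<^sub>T + c \<psi>\<^sub>T + 2 u \<psi> = 0\<close>, and the difference of its \<open>X\<close>-derivative and the second one is
  \<open>\<psi>\<^sub>T = A \<psi>\<close> with \<open>A = (c \<rho> - c - \<rho> u\<^sub>X) / 2\<close>. Inserting the latter into the former gives
  \<open>(A\<^sub>T + A\<^sup>2 + c A + 2 u) \<psi> = 0\<close>; the bracket is continuous and \<open>\<psi>\<close> vanishes on no open set, so the
  bracket vanishes, and this is the first 2-HS equation because \<open>\<rho> u\<^sub>X = u\<^sub>x\<close>. The new coordinate
  can be taken to be \<open>x = X - \<phi>\<^sub>T\<close>.\<close>

section \<open>Partial derivatives on the plane\<close>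

text \<open>The total derivative is written out in coordinates, so that both partial derivatives are
  visible at once and sum, product and chain rules become rules for pairs of numbers.\<close>

definition has_grad :: "(real \<times> real \<Rightarrow> real) \<Rightarrow> real \<Rightarrow> real \<Rightarrow> real \<times> real \<Rightarrow> bool" where
  "has_grad F a b p \<longleftrightarrow> (F has_derivative (\<lambda>(h, k). a * h + b * k)) (at p)"

lemma has_grad_partial1:
  assumes "has_grad F a b p"
  shows "((\<lambda>s. F (s, snd p)) has_real_derivative a) (at (fst p))"
proof -
  have "((\<lambda>s. F (s, snd p)) has_derivative (\<lambda>h. (\<lambda>(h, k). a * h + b * k) (h, 0))) (at (fst p))"
    by (rule has_derivative_compose[where f = "\<lambda>s. (s, snd p)" and g = F])
      (use assms in \<open>auto simp: has_grad_def intro!: derivative_eq_intros\<close>)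
  then show ?thesis
    by (simp add: has_field_derivative_def)
qed

lemma has_grad_partial2:
  assumes "has_grad F a b p"
  shows "((\<lambda>s. F (fst p, s)) has_real_derivative b) (at (snd p))"
proof -
  have "((\<lambda>s. F (fst p, s)) has_derivative (\<lambda>k. (\<lambda>(h, k). a * h + b * k) (0, k))) (at (snd p))"
    by (rule has_derivative_compose[where f = "\<lambda>s. (fst p, s)" and g = F])
      (use assms in \<open>auto simp: has_grad_def intro!: derivative_eq_intros\<close>)
  then show ?thesis
    by (simp add: has_field_derivative_def)
qed

lemma has_grad_pd1: "has_grad F a b p \<Longrightarrow> pd1 F p = a"
  unfolding pd1_def by (rule DERIV_imp_deriv[OF has_grad_partial1])

lemma has_grad_pd2: "has_grad F a b p \<Longrightarrow> pd2 F p = b"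
  unfolding pd2_def by (rule DERIV_imp_deriv[OF has_grad_partial2])

text \<open>A linear form on the plane is determined by its values at \<open>(1, 0)\<close> and
  \<open>(0, 1)\<close>, and these are the partial derivatives.\<close>

lemma differentiable_has_grad:
  assumes "F differentiable (at p)"
  shows "has_grad F (pd1 F p) (pd2 F p) p"
proof -
  obtain D where D: "(F has_derivative D) (at p)"
    using assms by (auto simp: differentiable_def)
  then have L: "linear D"
    by (rule has_derivative_linear)
  have eq: "D (h, k) = D (1, 0) * h + D (0, 1) * k" for h k
  proof -
    have "D (h, k) = D (h *\<^sub>R (1, 0) + k *\<^sub>R (0, 1))"
      by simp
    also have "\<dots> = h *\<^sub>R D (1, 0) + k *\<^sub>R D (0, 1)"
      using L by (simp only: linear_add linear_scale)
    finally show ?thesis by simp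
  qed
  have "D = (\<lambda>(h, k). D (1, 0) * h + D (0, 1) * k)"
    using eq by (intro ext) (simp only: case_prod_beta prod.collapse flip: eq)
  with D have "has_grad F (D (1, 0)) (D (0, 1)) p"
    by (simp add: has_grad_def)
  from this this[THEN has_grad_pd1] this[THEN has_grad_pd2] show ?thesis
    by simp
qed

lemma has_grad_differentiable: "has_grad F a b p \<Longrightarrow> F differentiable (at p)"
  by (auto simp: has_grad_def differentiable_def)

section \<open>Calculus rules for gradients\<close>

lemma has_grad_const: "has_grad (\<lambda>q. c) 0 0 p"
  by (auto simp: has_grad_def case_prod_unfold)

lemma has_grad_add:
  "has_grad F a b p \<Longrightarrow> has_grad G a' b' p \<Longrightarrow> has_grad (\<lambda>q. F q + G q) (a + a') (b + b') p"
  by (auto simp: has_grad_def case_prod_unfold algebra_simps intro!: derivative_eq_intros)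

lemma has_grad_diff:
  "has_grad F a b p \<Longrightarrow> has_grad G a' b' p \<Longrightarrow> has_grad (\<lambda>q. F q - G q) (a - a') (b - b') p"
  by (auto simp: has_grad_def case_prod_unfold algebra_simps intro!: derivative_eq_intros)

lemma has_grad_mult:
  "has_grad F a b p \<Longrightarrow> has_grad G a' b' p \<Longrightarrow>
    has_grad (\<lambda>q. F q * G q) (a * G p + F p * a') (b * G p + F p * b') p"
  by (auto simp: has_grad_def case_prod_unfold algebra_simps intro!: derivative_eq_intros)

lemma has_grad_DERIV_compose:
  assumes "has_grad F a b p" and "(\<phi> has_real_derivative d) (at (F p))"
  shows "has_grad (\<lambda>q. \<phi> (F q)) (d * a) (d * b) p"
proof -
  have "((\<lambda>q. \<phi> (F q)) has_derivative (\<lambda>v. d * (\<lambda>(h, k). a * h + b * k) v)) (at p)"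
    using assms unfolding has_grad_def has_field_derivative_def
    by (rule has_derivative_compose)
  then show ?thesis
    by (simp add: has_grad_def case_prod_unfold algebra_simps)
qed

text \<open>A coordinate line through \<open>p\<close> stays in the open set \<open>S\<close> near
  \<open>p\<close>. Identities known only on an open set can therefore be differentiated.\<close>

lemma pd_cong:
  assumes "open S" "p \<in> S" and eq: "\<And>q. q \<in> S \<Longrightarrow> F q = G q"
  shows "pd1 F p = pd1 G p" "pd2 F p = pd2 G p"
proof -
  have S: "\<forall>\<^sub>F q in nhds (fst p, snd p). q \<in> S"
    using assms(1,2) by (simp add: eventually_nhds_in_open)
  have "((\<lambda>s. (s, snd p)) \<longlongrightarrow> (fst p, snd p)) (nhds (fst p))"
    by (intro tendsto_intros filterlim_ident)
  from filterlim_iff[THEN iffD1, OF this, rule_format, OF S]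
  have "\<forall>\<^sub>F s in nhds (fst p). F (s, snd p) = G (s, snd p)"
    by eventually_elim (rule eq)
  then show "pd1 F p = pd1 G p"
    unfolding pd1_def by (rule deriv_cong_ev) simp
  have "((\<lambda>s. (fst p, s)) \<longlongrightarrow> (fst p, snd p)) (nhds (snd p))"
    by (intro tendsto_intros filterlim_ident)
  from filterlim_iff[THEN iffD1, OF this, rule_format, OF S]
  have "\<forall>\<^sub>F s in nhds (snd p). F (fst p, s) = G (fst p, s)"
    by eventually_elim (rule eq)
  then show "pd2 F p = pd2 G p"
    unfolding pd2_def by (rule deriv_cong_ev) simp
qed

lemma has_grad_cong:
  assumes "open S" "p \<in> S" "\<And>q. q \<in> S \<Longrightarrow> F q = G q" "has_grad F a b p"
  shows "has_grad G a b p"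
  using assms(4) unfolding has_grad_def
  by (rule has_derivative_transform_within_open[OF _ assms(1-3)])

section \<open>Functions of class \<open>C\<^sup>k\<close>\<close>

lemma Ck_on_has_grad: "Ck_on (Suc k) S F \<Longrightarrow> p \<in> S \<Longrightarrow> has_grad F (pd1 F p) (pd2 F p) p"
  by (simp add: differentiable_has_grad)

lemma Ck_on_cong:
  assumes "open S" "\<And>q. q \<in> S \<Longrightarrow> F q = G q" "Ck_on k S F"
  shows "Ck_on k S G"
  using assms(2,3)
proof (induction k arbitrary: F G)
  case 0
  then show ?case by (simp cong: continuous_on_cong)
next
  case (Suc k)
  have "G differentiable (at p)" if "p \<in> S" for p
    by (rule has_grad_differentiable)
      (rule has_grad_cong[OF \<open>open S\<close> that Suc.prems(1) Ck_on_has_grad[OF Suc.prems(2) that]])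
  moreover have "Ck_on k S (pd1 G)"
    by (rule Suc.IH[OF pd_cong(1)[OF \<open>open S\<close> _ Suc.prems(1)]]) (use Suc.prems(2) in simp_all)
  moreover have "Ck_on k S (pd2 G)"
    by (rule Suc.IH[OF pd_cong(2)[OF \<open>open S\<close> _ Suc.prems(1)]]) (use Suc.prems(2) in simp_all)
  ultimately show ?case by simp
qed

text \<open>Lets the partial derivatives be given by explicit formulas \<open>A\<close> and
  \<open>B\<close> on \<open>S\<close>; since \<open>S\<close> is open, agreement there carries over
  to all higher derivatives.\<close>

lemma Ck_on_SucI:
  assumes "open S" "\<And>p. p \<in> S \<Longrightarrow> has_grad F (A p) (B p) p" "Ck_on k S A" "Ck_on k S B"
  shows "Ck_on (Suc k) S F"
proof -
  have "Ck_on k S (pd1 F)"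
    by (rule Ck_on_cong[OF assms(1) has_grad_pd1[OF assms(2), symmetric] assms(3)])
  moreover have "Ck_on k S (pd2 F)"
    by (rule Ck_on_cong[OF assms(1) has_grad_pd2[OF assms(2), symmetric] assms(4)])
  ultimately show ?thesis
    using has_grad_differentiable[OF assms(2)] by simp
qed

text \<open>The recursion only descends through derivatives, so this is an induction whose base case
  is that differentiability implies continuity.\<close>

lemma Ck_on_SucD: "Ck_on (Suc k) S F \<Longrightarrow> Ck_on k S F"
proof (induction k arbitrary: F)
  case 0
  then show ?case
    by (auto intro!: continuous_at_imp_continuous_on differentiable_imp_continuous_within)
next
  case (Suc k)
  then show ?case
    by (metis Ck_on.simps(2))
qed

lemma Ck_on_le: "Ck_on m S F \<Longrightarrow> k \<le> m \<Longrightarrow> Ck_on k S F"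
  by (induction m) (auto simp: le_Suc_eq dest: Ck_on_SucD simp del: Ck_on.simps)

lemma Ck_on_subset: "Ck_on k S F \<Longrightarrow> S' \<subseteq> S \<Longrightarrow> Ck_on k S' F"
  by (induction k arbitrary: F) (auto intro: continuous_on_subset)

lemma Ck_on_continuous_on: "Ck_on k S F \<Longrightarrow> continuous_on S F"
  using Ck_on_le[of k S F 0] by simp

section \<open>Closure of \<open>C^k\<close> under arithmetic, inverses and logarithms\<close>

lemma Ck_on_const:
  assumes "open S"
  shows "Ck_on k S (\<lambda>q. c)"
proof (induction k arbitrary: c)
  case (Suc k)
  show ?case
    by (rule Ck_on_SucI[OF assms, where A = "\<lambda>q. 0" and B = "\<lambda>q. 0"])
      (simp_all add: has_grad_const Suc)
qed simp

lemma Ck_on_add: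
  assumes "open S" "Ck_on k S F" "Ck_on k S G"
  shows "Ck_on k S (\<lambda>q. F q + G q)"
  using assms(2,3)
proof (induction k arbitrary: F G)
  case 0
  then show ?case by (auto intro: continuous_intros)
next
  case (Suc k)
  show ?case
    by (rule Ck_on_SucI[OF \<open>open S\<close>
          has_grad_add[OF Ck_on_has_grad[OF Suc.prems(1)] Ck_on_has_grad[OF Suc.prems(2)]]])
      (use Suc in simp_all)
qed

lemma Ck_on_mult:
  assumes "open S" "Ck_on k S F" "Ck_on k S G"
  shows "Ck_on k S (\<lambda>q. F q * G q)"
  using assms(2,3)
proof (induction k arbitrary: F G)
  case 0
  then show ?case by (auto intro: continuous_intros)
next
  case (Suc k)
  note F = Suc.prems(1) and G = Suc.prems(2)
  from F G have FG: "Ck_on k S F" "Ck_on k S G"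
    by (simp_all only: Ck_on_SucD)
  show ?case
    by (rule Ck_on_SucI[OF \<open>open S\<close>
          has_grad_mult[OF Ck_on_has_grad[OF F] Ck_on_has_grad[OF G]]])
      (use F G FG in \<open>auto intro!: Ck_on_add Suc.IH \<open>open S\<close>\<close>)
qed

lemma Ck_on_diff:
  assumes "open S" "Ck_on k S F" "Ck_on k S G"
  shows "Ck_on k S (\<lambda>q. F q - G q)"
  using Ck_on_add[OF assms(1,2) Ck_on_mult[OF assms(1) Ck_on_const[OF assms(1), of k "-1"] assms(3)]]
  by simp

text \<open>The gradient of \<open>1 / F\<close> is \<open>- (1 / F)^2\<close> times that of
  \<open>F\<close>, and the induction hypothesis applies to \<open>1 / F\<close> itself.\<close>

lemma Ck_on_inverse:
  assumes "open S" "Ck_on k S F" and nz: "\<And>q. q \<in> S \<Longrightarrow> F q \<noteq> 0"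
  shows "Ck_on k S (\<lambda>q. inverse (F q))"
  using assms(2)
proof (induction k)
  case 0
  then show ?case using nz by (auto intro: continuous_intros)
next
  case (Suc k)
  have IH: "Ck_on k S (\<lambda>q. inverse (F q))"
    using Suc by (simp only: Ck_on_SucD)
  have grad: "has_grad (\<lambda>q. inverse (F q)) (- (inverse (F p) * inverse (F p)) * pd1 F p)
      (- (inverse (F p) * inverse (F p)) * pd2 F p) p" if "p \<in> S" for p
    by (rule has_grad_DERIV_compose[OF Ck_on_has_grad[OF Suc.prems that]])
      (use nz[OF that] in \<open>auto intro!: derivative_eq_intros\<close>)
  have C: "Ck_on k S (\<lambda>p. - (inverse (F p) * inverse (F p)) * P p)" if "Ck_on k S P" for P
    using Ck_on_mult[OF \<open>open S\<close> Ck_on_mult[OF \<open>open S\<close> Ck_on_const[of S k "-1"]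
      Ck_on_mult[OF \<open>open S\<close> IH IH]] that] \<open>open S\<close> by simp
  show ?case
    by (rule Ck_on_SucI[OF \<open>open S\<close> grad]) (use Suc.prems in \<open>simp_all only: Ck_on.simps C\<close>)
qed

lemma has_grad_ln:
  assumes "Ck_on (Suc k) S F" "\<And>q. q \<in> S \<Longrightarrow> F q > 0" "p \<in> S"
  shows "has_grad (\<lambda>q. ln (F q)) (inverse (F p) * pd1 F p) (inverse (F p) * pd2 F p) p"
  by (rule has_grad_DERIV_compose[OF Ck_on_has_grad[OF assms(1,3)]])
    (use assms(2)[OF assms(3)] in \<open>auto intro!: derivative_eq_intros simp: field_simps\<close>)

text \<open>No induction is involved: the gradient is \<open>1 / F\<close> times that of
  \<open>F\<close>, which the result on inverses covers.\<close>

lemma Ck_on_ln: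
  assumes "open S" "Ck_on k S F" and pos: "\<And>q. q \<in> S \<Longrightarrow> F q > 0"
  shows "Ck_on k S (\<lambda>q. ln (F q))"
proof -
  have nz: "F q \<noteq> 0" if "q \<in> S" for q
    using pos[OF that] by simp
  show ?thesis
  proof (cases k)
    case 0
    then show ?thesis
      using assms(2) nz by (auto intro!: continuous_intros)
  next
    case (Suc m)
    have F: "Ck_on (Suc m) S F"
      using assms(2) Suc by simp
    have inv: "Ck_on m S (\<lambda>q. inverse (F q))"
      by (rule Ck_on_inverse[OF assms(1) Ck_on_SucD[OF F] nz])
    show ?thesis unfolding Suc
      by (rule Ck_on_SucI[OF \<open>open S\<close> has_grad_ln[OF F pos]])
        (use F in \<open>simp_all add: Ck_on_mult[OF \<open>open S\<close> inv]\<close>)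
  qed
qed

text \<open>The mean value theorem in each variable, applied in the two possible orders.\<close>

lemma mixed_difference:
  fixes F :: "real \<times> real \<Rightarrow> real"
  assumes "h > 0"
    and sub: "{a..a + h} \<times> {b..b + h} \<subseteq> S"
    and C: "Ck_on 2 S F"
  shows "\<exists>x\<in>{a..a + h}. \<exists>y\<in>{b..b + h}.
    F (a + h, b + h) - F (a + h, b) - F (a, b + h) + F (a, b) = h * h * pd2 (pd1 F) (x, y)"
    and "\<exists>x\<in>{a..a + h}. \<exists>y\<in>{b..b + h}.
    F (a + h, b + h) - F (a + h, b) - F (a, b + h) + F (a, b) = h * h * pd1 (pd2 F) (x, y)"
proof -
  have F: "has_grad F (pd1 F p) (pd2 F p) p"
    and F1: "has_grad (pd1 F) (pd1 (pd1 F) p) (pd2 (pd1 F) p) p"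
    and F2: "has_grad (pd2 F) (pd1 (pd2 F) p) (pd2 (pd2 F) p) p" if "p \<in> S" for p
    using C that by (auto simp: numeral_2_eq_2 intro: differentiable_has_grad)
  have S: "(x, y) \<in> S" if "a \<le> x" "x \<le> a + h" "b \<le> y" "y \<le> b + h" for x y
    using that sub by auto
  have "\<exists>x. a < x \<and> x < a + h \<and>
      (F (a + h, b + h) - F (a + h, b)) - (F (a, b + h) - F (a, b)) =
      (a + h - a) * (pd1 F (x, b + h) - pd1 F (x, b))"
    by (rule MVT2[where f = "\<lambda>x. F (x, b + h) - F (x, b)"])
      (use \<open>h > 0\<close> has_grad_partial1[OF F[OF S]] in \<open>auto intro!: DERIV_diff\<close>)
  then obtain x where x: "a < x" "x < a + h"
    and eq: "(F (a + h, b + h) - F (a + h, b)) - (F (a, b + h) - F (a, b)) =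
      h * (pd1 F (x, b + h) - pd1 F (x, b))" by auto
  have "\<exists>y. b < y \<and> y < b + h \<and>
      pd1 F (x, b + h) - pd1 F (x, b) = (b + h - b) * pd2 (pd1 F) (x, y)"
    by (rule MVT2[where f = "\<lambda>y. pd1 F (x, y)"])
      (use \<open>h > 0\<close> x has_grad_partial2[OF F1[OF S]] in auto)
  then obtain y where "b < y" "y < b + h"
    "pd1 F (x, b + h) - pd1 F (x, b) = h * pd2 (pd1 F) (x, y)" by auto
  with x eq show "\<exists>x\<in>{a..a + h}. \<exists>y\<in>{b..b + h}.
    F (a + h, b + h) - F (a + h, b) - F (a, b + h) + F (a, b) = h * h * pd2 (pd1 F) (x, y)"
    by (intro bexI[of _ x] bexI[of _ y]) auto
  have "\<exists>y. b < y \<and> y < b + h \<and>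
      (F (a + h, b + h) - F (a, b + h)) - (F (a + h, b) - F (a, b)) =
      (b + h - b) * (pd2 F (a + h, y) - pd2 F (a, y))"
    by (rule MVT2[where f = "\<lambda>y. F (a + h, y) - F (a, y)"])
      (use \<open>h > 0\<close> has_grad_partial2[OF F[OF S]] in \<open>auto intro!: DERIV_diff\<close>)
  then obtain y where y: "b < y" "y < b + h"
    and eq: "(F (a + h, b + h) - F (a, b + h)) - (F (a + h, b) - F (a, b)) =
      h * (pd2 F (a + h, y) - pd2 F (a, y))" by auto
  have "\<exists>x. a < x \<and> x < a + h \<and>
      pd2 F (a + h, y) - pd2 F (a, y) = (a + h - a) * pd1 (pd2 F) (x, y)"
    by (rule MVT2[where f = "\<lambda>x. pd2 F (x, y)"])
      (use \<open>h > 0\<close> y has_grad_partial1[OF F2[OF S]] in auto)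
  then obtain x where "a < x" "x < a + h"
    "pd2 F (a + h, y) - pd2 F (a, y) = h * pd1 (pd2 F) (x, y)" by auto
  with y eq show "\<exists>x\<in>{a..a + h}. \<exists>y\<in>{b..b + h}.
    F (a + h, b + h) - F (a + h, b) - F (a, b + h) + F (a, b) = h * h * pd1 (pd2 F) (x, y)"
    by (intro bexI[of _ x] bexI[of _ y]) auto
qed

text \<open>On a small square at \<open>p\<close> the same second difference equals
  \<open>h * h\<close> times either mixed derivative at some point of the square. Continuity of both
  at \<open>p\<close> then forces equality.\<close>

lemma pd_commute:
  assumes "open S" "p \<in> S" and C: "Ck_on 2 S F"
  shows "pd1 (pd2 F) p = pd2 (pd1 F) p"
proof -
  obtain a b where p: "p = (a, b)" by fastforce
  have cont: "continuous_on S (pd1 (pd2 F))" "continuous_on S (pd2 (pd1 F))"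
    using C by (auto simp: numeral_2_eq_2)
  have "\<bar>pd1 (pd2 F) p - pd2 (pd1 F) p\<bar> \<le> e" if "e > 0" for e
  proof -
    obtain d1 where d1: "d1 > 0" "ball p d1 \<subseteq> S"
      using assms(1,2) openE by blast
    obtain d2 where d2: "d2 > 0"
      "\<And>q. q \<in> S \<Longrightarrow> dist q p < d2 \<Longrightarrow> dist (pd1 (pd2 F) q) (pd1 (pd2 F) p) < e / 2"
      using cont(1) \<open>p \<in> S\<close> \<open>e > 0\<close> unfolding continuous_on_iff by (meson half_gt_zero)
    obtain d3 where d3: "d3 > 0"
      "\<And>q. q \<in> S \<Longrightarrow> dist q p < d3 \<Longrightarrow> dist (pd2 (pd1 F) q) (pd2 (pd1 F) p) < e / 2"
      using cont(2) \<open>p \<in> S\<close> \<open>e > 0\<close> unfolding continuous_on_iff by (meson half_gt_zero)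
    \<comment> \<open>Points of the square with side \<open>h\<close> lie within
      \<open>2 * h\<close> of \<open>p\<close>; dividing by 3 keeps this strictly below all three
      radii.\<close>
    define h where "h = min d1 (min d2 d3) / 3"
    have h: "h > 0" "2 * h < d1" "2 * h < d2" "2 * h < d3"
      using d1(1) d2(1) d3(1) by (auto simp: h_def)
    have near: "dist q p \<le> 2 * h" if "q \<in> {a..a + h} \<times> {b..b + h}" for q
    proof -
      obtain x y where q: "q = (x, y)" by fastforce
      have "dist q p = sqrt ((dist x a)\<^sup>2 + (dist y b)\<^sup>2)"
        by (simp add: q p dist_Pair_Pair)
      also have "\<dots> \<le> dist x a + dist y b"
        by (rule sqrt_sum_squares_le_sum) auto
      also have "\<dots> \<le> 2 * h"
        using that by (auto simp: q dist_real_def)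
      finally show ?thesis .
    qed
    have sub: "{a..a + h} \<times> {b..b + h} \<subseteq> S"
    proof
      fix q assume "q \<in> {a..a + h} \<times> {b..b + h}"
      then have "q \<in> ball p d1"
        using near[of q] h by (simp add: dist_commute)
      then show "q \<in> S"
        using d1(2) by blast
    qed
    obtain x y where xy: "(x, y) \<in> {a..a + h} \<times> {b..b + h}"
      "F (a + h, b + h) - F (a + h, b) - F (a, b + h) + F (a, b) = h * h * pd2 (pd1 F) (x, y)"
      using mixed_difference(1)[OF h(1) sub C] by auto
    obtain x' y' where xy': "(x', y') \<in> {a..a + h} \<times> {b..b + h}"
      "F (a + h, b + h) - F (a + h, b) - F (a, b + h) + F (a, b) = h * h * pd1 (pd2 F) (x', y')"
      using mixed_difference(2)[OF h(1) sub C] by auto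
    have eq: "pd2 (pd1 F) (x, y) = pd1 (pd2 F) (x', y')"
      using xy(2) xy'(2) h(1) by auto
    have "dist (pd2 (pd1 F) (x, y)) (pd2 (pd1 F) p) < e / 2"
      using xy(1) sub near[of "(x, y)"] h by (intro d3(2)) auto
    moreover have "dist (pd1 (pd2 F) (x', y')) (pd1 (pd2 F) p) < e / 2"
      using xy'(1) sub near[of "(x', y')"] h by (intro d2(2)) auto
    ultimately show ?thesis
      using eq unfolding dist_real_def by linarith
  qed
  then have "\<bar>pd1 (pd2 F) p - pd2 (pd1 F) p\<bar> \<le> 0"
    by (rule field_le_epsilon) simp
  then show ?thesis by simp
qed

section \<open>The bilinear equations\<close>

text \<open>Three products suffice because \<open>D\<^sub>T\<^sup>2\<close>, before restriction to
  the diagonal, produces exactly three; a zero coefficient fills the place of a missing one.\<close>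

lemma hirota_three_products:
  fixes K :: two_point
  assumes "open U" "p \<in> U" "q \<in> U"
    and K: "\<And>a b. a \<in> U \<Longrightarrow> b \<in> U \<Longrightarrow>
      K a b = k1 * (A1 a * B1 b) + k2 * (A2 a * B2 b) + k3 * (A3 a * B3 b)"
    and "Ck_on 1 U A1" "Ck_on 1 U A2" "Ck_on 1 U A3" "Ck_on 1 U B1" "Ck_on 1 U B2" "Ck_on 1 U B3"
  shows "hirota_X K p q = k1 * (pd1 A1 p * B1 q - A1 p * pd1 B1 q)
      + k2 * (pd1 A2 p * B2 q - A2 p * pd1 B2 q) + k3 * (pd1 A3 p * B3 q - A3 p * pd1 B3 q)"
    and "hirota_T K p q = k1 * (pd2 A1 p * B1 q - A1 p * pd2 B1 q)
      + k2 * (pd2 A2 p * B2 q - A2 p * pd2 B2 q) + k3 * (pd2 A3 p * B3 q - A3 p * pd2 B3 q)"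
proof -
  \<comment> \<open>\<open>K\<close> has the product form only on \<open>U \<times> U\<close>, so
    gradients are computed for \<open>L\<close> and transferred locally.\<close>
  define L where "L = (\<lambda>a b. k1 * (A1 a * B1 b) + k2 * (A2 a * B2 b) + k3 * (A3 a * B3 b))"
  note grad = Ck_on_has_grad[where k = 0 and S = U, simplified One_nat_def[symmetric]]
  have L1: "has_grad (\<lambda>r. L r q)
      (k1 * (pd1 A1 p * B1 q) + k2 * (pd1 A2 p * B2 q) + k3 * (pd1 A3 p * B3 q))
      (k1 * (pd2 A1 p * B1 q) + k2 * (pd2 A2 p * B2 q) + k3 * (pd2 A3 p * B3 q)) p"
    unfolding L_def
    using has_grad_add[OF has_grad_add[OF
      has_grad_mult[OF has_grad_const[of k1] has_grad_mult[OF grad[OF assms(5,2)] has_grad_const[of "B1 q"]]]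
      has_grad_mult[OF has_grad_const[of k2] has_grad_mult[OF grad[OF assms(6,2)] has_grad_const[of "B2 q"]]]]
      has_grad_mult[OF has_grad_const[of k3] has_grad_mult[OF grad[OF assms(7,2)] has_grad_const[of "B3 q"]]]]
    by simp
  have L2: "has_grad (\<lambda>r. L p r)
      (k1 * (A1 p * pd1 B1 q) + k2 * (A2 p * pd1 B2 q) + k3 * (A3 p * pd1 B3 q))
      (k1 * (A1 p * pd2 B1 q) + k2 * (A2 p * pd2 B2 q) + k3 * (A3 p * pd2 B3 q)) q"
    unfolding L_def
    using has_grad_add[OF has_grad_add[OF
      has_grad_mult[OF has_grad_const[of k1] has_grad_mult[OF has_grad_const[of "A1 p"] grad[OF assms(8,3)]]]
      has_grad_mult[OF has_grad_const[of k2] has_grad_mult[OF has_grad_const[of "A2 p"] grad[OF assms(9,3)]]]]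
      has_grad_mult[OF has_grad_const[of k3] has_grad_mult[OF has_grad_const[of "A3 p"] grad[OF assms(10,3)]]]]
    by simp
  have K1: "has_grad (\<lambda>r. K r q)
      (k1 * (pd1 A1 p * B1 q) + k2 * (pd1 A2 p * B2 q) + k3 * (pd1 A3 p * B3 q))
      (k1 * (pd2 A1 p * B1 q) + k2 * (pd2 A2 p * B2 q) + k3 * (pd2 A3 p * B3 q)) p"
    by (rule has_grad_cong[OF assms(1,2) _ L1]) (simp add: L_def K \<open>q \<in> U\<close>)
  have K2: "has_grad (\<lambda>r. K p r)
      (k1 * (A1 p * pd1 B1 q) + k2 * (A2 p * pd1 B2 q) + k3 * (A3 p * pd1 B3 q))
      (k1 * (A1 p * pd2 B1 q) + k2 * (A2 p * pd2 B2 q) + k3 * (A3 p * pd2 B3 q)) q"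
    by (rule has_grad_cong[OF assms(1,3) _ L2]) (simp add: L_def K \<open>p \<in> U\<close>)
  show "hirota_X K p q = k1 * (pd1 A1 p * B1 q - A1 p * pd1 B1 q)
      + k2 * (pd1 A2 p * B2 q - A2 p * pd1 B2 q) + k3 * (pd1 A3 p * B3 q - A3 p * pd1 B3 q)"
    unfolding hirota_X_def has_grad_pd1[OF K1] has_grad_pd1[OF K2] by algebra
  show "hirota_T K p q = k1 * (pd2 A1 p * B1 q - A1 p * pd2 B1 q)
      + k2 * (pd2 A2 p * B2 q - A2 p * pd2 B2 q) + k3 * (pd2 A3 p * B3 q - A3 p * pd2 B3 q)"
    unfolding hirota_T_def has_grad_pd2[OF K1] has_grad_pd2[OF K2] by algebra
qed

lemma Ck_on_pd:
  assumes "Ck_on (Suc k) S F"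
  shows "Ck_on k S (pd1 F)" "Ck_on k S (pd2 F)"
  using assms by simp_all

context
  fixes U :: "(real \<times> real) set" and f g :: "real \<times> real \<Rightarrow> real"
  assumes U: "open U" and f: "Ck_on 3 U f" and g: "Ck_on 3 U g"
begin

lemma Ck_on_1_T:
  "Ck_on 1 U f" "Ck_on 1 U (pd2 f)" "Ck_on 1 U (pd2 (pd2 f))"
  "Ck_on 1 U g" "Ck_on 1 U (pd2 g)" "Ck_on 1 U (pd2 (pd2 g))"
proof -
  have *: "Ck_on 1 U F" "Ck_on 1 U (pd2 F)" "Ck_on 1 U (pd2 (pd2 F))" if "Ck_on 3 U F" for F
  proof -
    have 2: "Ck_on 2 U (pd2 F)"
      using that by (simp add: numeral_3_eq_3 numeral_2_eq_2)
    then show "Ck_on 1 U (pd2 (pd2 F))"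
      by (simp add: numeral_2_eq_2)
    show "Ck_on 1 U F" "Ck_on 1 U (pd2 F)"
      by (rule Ck_on_le[OF that] Ck_on_le[OF 2], simp)+
  qed
  show "Ck_on 1 U f" "Ck_on 1 U (pd2 f)" "Ck_on 1 U (pd2 (pd2 f))"
    "Ck_on 1 U g" "Ck_on 1 U (pd2 g)" "Ck_on 1 U (pd2 (pd2 g))"
    using *[OF f] *[OF g] by simp_all
qed

text \<open>The two points stay independent, since further Hirota operators act before the
  restriction to the diagonal.\<close>

lemma hirota_T_explicit:
  assumes "p \<in> U" "q \<in> U"
  shows "hirota_T (\<lambda>a b. g a * f b) p q = pd2 g p * f q - g p * pd2 f q"
  using hirota_three_products(2)[OF U assms, of "\<lambda>a b. g a * f b" 1 g f 0 f f 0 f f] Ck_on_1_T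
  by simp

lemma hirota_TT_explicit:
  assumes "p \<in> U" "q \<in> U"
  shows "hirota_T (hirota_T (\<lambda>a b. g a * f b)) p q =
    pd2 (pd2 g) p * f q - 2 * pd2 g p * pd2 f q + g p * pd2 (pd2 f) q"
  using hirota_three_products(2)[OF U assms, of "hirota_T (\<lambda>a b. g a * f b)"
      1 "pd2 g" f "-1" g "pd2 f" 0 f f] Ck_on_1_T
  by (simp add: hirota_T_explicit)

lemma hirota_explicit:
  assumes "p \<in> U"
  shows "hirota 0 1 g f p = pd2 g p * f p - g p * pd2 f p"
    and "hirota 0 2 g f p = pd2 (pd2 g) p * f p - 2 * pd2 g p * pd2 f p + g p * pd2 (pd2 f) p"
    and "hirota 1 1 g f p = pd1 (pd2 g) p * f p - pd2 g p * pd1 f p - pd1 g p * pd2 f p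
      + g p * pd1 (pd2 f) p"
    and "hirota 1 2 g f p = pd1 (pd2 (pd2 g)) p * f p - pd2 (pd2 g) p * pd1 f p
      - 2 * pd1 (pd2 g) p * pd2 f p + 2 * pd2 g p * pd1 (pd2 f) p
      + pd1 g p * pd2 (pd2 f) p - g p * pd1 (pd2 (pd2 f)) p"
proof -
  show "hirota 0 1 g f p = pd2 g p * f p - g p * pd2 f p"
    using assms by (simp add: hirota_def hirota_T_explicit)
  show "hirota 0 2 g f p = pd2 (pd2 g) p * f p - 2 * pd2 g p * pd2 f p + g p * pd2 (pd2 f) p"
    using assms by (simp add: hirota_def hirota_TT_explicit numeral_2_eq_2)
  show "hirota 1 1 g f p = pd1 (pd2 g) p * f p - pd2 g p * pd1 f p - pd1 g p * pd2 f p
      + g p * pd1 (pd2 f) p"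
    using hirota_three_products(1)[OF U assms assms, of "hirota_T (\<lambda>a b. g a * f b)"
        1 "pd2 g" f "-1" g "pd2 f" 0 f f] Ck_on_1_T
    by (simp add: hirota_T_explicit hirota_def)
  show "hirota 1 2 g f p = pd1 (pd2 (pd2 g)) p * f p - pd2 (pd2 g) p * pd1 f p
      - 2 * pd1 (pd2 g) p * pd2 f p + 2 * pd2 g p * pd1 (pd2 f) p
      + pd1 g p * pd2 (pd2 f) p - g p * pd1 (pd2 (pd2 f)) p"
    using hirota_three_products(1)[OF U assms assms, of "hirota_T (hirota_T (\<lambda>a b. g a * f b))"
        1 "pd2 (pd2 g)" f "-2" "pd2 g" "pd2 f" 1 g "pd2 (pd2 f)"] Ck_on_1_T
    by (simp add: hirota_TT_explicit hirota_def numeral_2_eq_2)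
qed

text \<open>The \<open>X\<close>-derivative of the first bilinear equation, compared with the second one, eliminates
  the third derivatives of \<open>g\<close>.\<close>

lemma bilinear_eqs_imp:
  assumes "bilinear_eqs c U g f" "p \<in> U"
  shows "pd2 (pd2 g) p * f p - 2 * pd2 g p * pd2 f p + g p * pd2 (pd2 f) p
      + c * (pd2 g p * f p - g p * pd2 f p) = 0"
    and "pd2 (pd2 g) p * pd1 f p - 2 * pd2 g p * pd1 (pd2 f) p + g p * pd1 (pd2 (pd2 f)) p
      + c * (pd2 g p * pd1 f p - g p * pd1 (pd2 f) p) + 2 * (pd2 g p * f p - g p * pd2 f p) = 0"
proof -
  let ?E = "\<lambda>q. pd2 (pd2 g) q * f q - 2 * (pd2 g q * pd2 f q) + g q * pd2 (pd2 f) q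
      + c * (pd2 g q * f q - g q * pd2 f q)"
  have E0: "?E q = 0" if "q \<in> U" for q
    using assms(1) that by (simp add: bilinear_eqs_def hirota_explicit mult.assoc del: One_nat_def)
  then show "pd2 (pd2 g) p * f p - 2 * pd2 g p * pd2 f p + g p * pd2 (pd2 f) p
      + c * (pd2 g p * f p - g p * pd2 f p) = 0"
    using assms(2) by (simp add: mult.assoc)
  note grad = Ck_on_1_T[THEN Ck_on_has_grad[where k = 0 and S = U,
      simplified One_nat_def[symmetric]], OF assms(2)]
  \<comment> \<open>The first equation holds on the whole open set \<open>U\<close>, so its
    \<open>X\<close>-derivative vanishes as well.\<close>
  have "pd1 (\<lambda>q. 0) p = pd1 ?E p"
    using E0 by (intro pd_cong(1)[OF U assms(2)]) simp
  then have "0 = pd1 ?E p"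
    by (simp add: has_grad_pd1[OF has_grad_const])
  also have "pd1 ?E p = pd1 (pd2 (pd2 g)) p * f p + pd2 (pd2 g) p * pd1 f p
      - 2 * (pd1 (pd2 g) p * pd2 f p + pd2 g p * pd1 (pd2 f) p)
      + (pd1 g p * pd2 (pd2 f) p + g p * pd1 (pd2 (pd2 f)) p)
      + c * (pd1 (pd2 g) p * f p + pd2 g p * pd1 f p - (pd1 g p * pd2 f p + g p * pd1 (pd2 f) p))"
    using has_grad_pd1[OF has_grad_add[OF has_grad_add[OF has_grad_diff[OF
      has_grad_mult[OF grad(6) grad(1)]
      has_grad_mult[OF has_grad_const[of 2] has_grad_mult[OF grad(5) grad(2)]]]
      has_grad_mult[OF grad(4) grad(3)]]
      has_grad_mult[OF has_grad_const[of c] has_grad_diff[OF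
      has_grad_mult[OF grad(5) grad(1)] has_grad_mult[OF grad(4) grad(2)]]]]]
    by simp
  finally have E1: "0 = \<dots>" .
  have "hirota 1 2 g f p + c * hirota 1 1 g f p - 4 * hirota 0 1 g f p = 0"
    using assms by (simp add: bilinear_eqs_def)
  then have "pd1 (pd2 (pd2 g)) p * f p - pd2 (pd2 g) p * pd1 f p
      - 2 * pd1 (pd2 g) p * pd2 f p + 2 * pd2 g p * pd1 (pd2 f) p
      + pd1 g p * pd2 (pd2 f) p - g p * pd1 (pd2 (pd2 f)) p
      + c * (pd1 (pd2 g) p * f p - pd2 g p * pd1 f p - pd1 g p * pd2 f p + g p * pd1 (pd2 f) p)
      - 4 * (pd2 g p * f p - g p * pd2 f p) = 0"
    unfolding hirota_explicit[OF assms(2)] .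
  \<comment> \<open>The difference of the two identities is twice the claim: all terms with an
    \<open>X\<close>-derivative of \<open>g\<close> cancel.\<close>
  with E1 show "pd2 (pd2 g) p * pd1 f p - 2 * pd2 g p * pd1 (pd2 f) p + g p * pd1 (pd2 (pd2 f)) p
      + c * (pd2 g p * pd1 f p - g p * pd1 (pd2 f) p) + 2 * (pd2 g p * f p - g p * pd2 f p) = 0"
    by (simp add: algebra_simps)
qed

end

text \<open>Since \<open>f\<close> is the exponential of \<phi>, each derivative of \<open>f\<close>
  is \<open>f\<close> times a polynomial in derivatives of \<phi>. This makes \<open>f\<close> a
  common factor of the bilinear equations.\<close>

lemma pd_exp_log:
  assumes U: "open U" and f: "Ck_on 3 U f" and pos: "\<forall>q\<in>U. f q > 0" and p: "p \<in> U"
  defines "\<phi> \<equiv> \<lambda>q. ln (f q)"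
  shows "pd1 f p = pd1 \<phi> p * f p" "pd2 f p = pd2 \<phi> p * f p"
    and "pd1 (pd2 f) p = (pd1 (pd2 \<phi>) p + pd1 \<phi> p * pd2 \<phi> p) * f p"
    and "pd2 (pd2 f) p = (pd2 (pd2 \<phi>) p + (pd2 \<phi> p)\<^sup>2) * f p"
    and "pd1 (pd2 (pd2 f)) p = (pd1 (pd2 (pd2 \<phi>)) p + 2 * pd2 \<phi> p * pd1 (pd2 \<phi>) p
      + pd1 \<phi> p * (pd2 (pd2 \<phi>) p + (pd2 \<phi> p)\<^sup>2)) * f p"
proof -
  have \<phi>: "Ck_on 3 U \<phi>"
    unfolding \<phi>_def by (rule Ck_on_ln[OF U f]) (simp add: pos)
  have grad_f: "has_grad f (pd1 f q) (pd2 f q) q" if "q \<in> U" for q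
    using Ck_on_has_grad[of 2 U f q] f that by (simp add: numeral_3_eq_3 numeral_2_eq_2)
  have grad_\<phi>: "has_grad (pd2 \<phi>) (pd1 (pd2 \<phi>) q) (pd2 (pd2 \<phi>) q) q"
    "has_grad (pd2 (pd2 \<phi>)) (pd1 (pd2 (pd2 \<phi>)) q) (pd2 (pd2 (pd2 \<phi>)) q) q" if "q \<in> U" for q
    using \<phi> that by (auto simp: numeral_3_eq_3 differentiable_has_grad)
  have f1: "pd1 f q = pd1 \<phi> q * f q" "pd2 f q = pd2 \<phi> q * f q" if "q \<in> U" for q
  proof -
    have "has_grad \<phi> (inverse (f q) * pd1 f q) (inverse (f q) * pd2 f q) q"
      unfolding \<phi>_def using f pos by (intro has_grad_ln[OF _ _ that, of 2])
        (simp_all add: numeral_3_eq_3 numeral_2_eq_2)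
    from has_grad_pd1[OF this] has_grad_pd2[OF this]
    show "pd1 f q = pd1 \<phi> q * f q" "pd2 f q = pd2 \<phi> q * f q"
      using bspec[OF pos that] by (simp_all add: field_simps)
  qed
  show "pd1 f p = pd1 \<phi> p * f p" "pd2 f p = pd2 \<phi> p * f p"
    using f1 p by auto
  have grad2: "has_grad (pd2 f) (pd1 (pd2 \<phi>) q * f q + pd2 \<phi> q * pd1 f q)
      (pd2 (pd2 \<phi>) q * f q + pd2 \<phi> q * pd2 f q) q" if "q \<in> U" for q
    by (rule has_grad_cong[OF U that f1(2)[symmetric] has_grad_mult[OF grad_\<phi>(1) grad_f]])
      (use that in simp_all)
  show "pd1 (pd2 f) p = (pd1 (pd2 \<phi>) p + pd1 \<phi> p * pd2 \<phi> p) * f p"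
    using has_grad_pd1[OF grad2[OF p]] f1[OF p] by (simp add: algebra_simps)
  have f22: "pd2 (pd2 f) q = (pd2 (pd2 \<phi>) q + pd2 \<phi> q * pd2 \<phi> q) * f q" if "q \<in> U" for q
    using has_grad_pd2[OF grad2[OF that]] f1[OF that] by (simp add: algebra_simps)
  from this[OF p] show "pd2 (pd2 f) p = (pd2 (pd2 \<phi>) p + (pd2 \<phi> p)\<^sup>2) * f p"
    by (simp add: power2_eq_square)
  have "has_grad (pd2 (pd2 f))
      ((pd1 (pd2 (pd2 \<phi>)) p + (pd1 (pd2 \<phi>) p * pd2 \<phi> p + pd2 \<phi> p * pd1 (pd2 \<phi>) p)) * f p
        + (pd2 (pd2 \<phi>) p + pd2 \<phi> p * pd2 \<phi> p) * pd1 f p)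
      ((pd2 (pd2 (pd2 \<phi>)) p + (pd2 (pd2 \<phi>) p * pd2 \<phi> p + pd2 \<phi> p * pd2 (pd2 \<phi>) p)) * f p
        + (pd2 (pd2 \<phi>) p + pd2 \<phi> p * pd2 \<phi> p) * pd2 f p) p"
    using p by (intro has_grad_cong[OF U p f22[symmetric]] has_grad_mult has_grad_add grad_\<phi> grad_f)
  from has_grad_pd1[OF this]
  show "pd1 (pd2 (pd2 f)) p = (pd1 (pd2 (pd2 \<phi>)) p + 2 * pd2 \<phi> p * pd1 (pd2 \<phi>) p
      + pd1 \<phi> p * (pd2 (pd2 \<phi>) p + (pd2 \<phi> p)\<^sup>2)) * f p"
    using f1[OF p] by (simp add: algebra_simps power2_eq_square)
qed

section \<open>The reduced equations in the variables X and T\<close>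

context
  fixes c :: real and U :: "(real \<times> real) set"
    and f g u \<rho> \<phi> :: "real \<times> real \<Rightarrow> real"
  assumes U: "open U"
    and f: "Ck_on 4 U f" and g: "Ck_on 3 U g"
    and pos: "\<And>p. p \<in> U \<Longrightarrow> f p > 0"
    and bilinear: "bilinear_eqs c U g f"
    and \<phi>: "\<phi> = (\<lambda>q. ln (f q))"
    and u: "\<And>p. p \<in> U \<Longrightarrow> u p = pd2 (pd2 \<phi>) p"
    and \<rho>: "\<And>p. p \<in> U \<Longrightarrow> \<rho> p = 1 / (1 - pd2 (pd1 \<phi>) p)"
    and nz: "\<And>p. p \<in> U \<Longrightarrow> 1 - pd2 (pd1 \<phi>) p \<noteq> 0"
begin

lemma f_pos: "\<forall>p\<in>U. f p > 0"
  using pos by blast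

lemma Ck_on_phi: "Ck_on 4 U \<phi>"
  unfolding \<phi> by (rule Ck_on_ln[OF U f pos])

lemma Ck_on_phi_pd: "Ck_on 3 U (pd1 \<phi>)" "Ck_on 3 U (pd2 \<phi>)" "Ck_on 2 U (pd2 (pd1 \<phi>))"
    "Ck_on 2 U (pd2 (pd2 \<phi>))"
  using Ck_on_phi by (simp_all add: eval_nat_numeral)

text \<open>Two of the four derivatives of \<phi> are spent in forming \<open>u\<close>; the
  remaining two are those that \<open>two_HS\<close> asks for.\<close>

lemma Ck_on_u: "Ck_on 2 U u"
  by (rule Ck_on_cong[OF U u[symmetric] Ck_on_phi_pd(4)])

lemma Ck_on_rho: "Ck_on 2 U \<rho>"
proof (rule Ck_on_cong[OF U])
  show "Ck_on 2 U (\<lambda>q. inverse (1 - pd2 (pd1 \<phi>) q))"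
    by (intro Ck_on_inverse Ck_on_diff Ck_on_const U Ck_on_phi_pd nz)
qed (simp add: \<rho> field_simps)

lemma rho_nonzero: "p \<in> U \<Longrightarrow> \<rho> p \<noteq> 0"
  using nz[of p] by (simp add: \<rho>)

lemma pd_phi_XT:
  assumes "p \<in> U"
  shows "pd1 (pd2 \<phi>) p = 1 - 1 / \<rho> p"
proof -
  have "pd1 (pd2 \<phi>) p = pd2 (pd1 \<phi>) p"
    by (rule pd_commute[OF U assms Ck_on_le[OF Ck_on_phi]]) simp
  then show ?thesis
    using nz[OF assms] by (simp add: \<rho>[OF assms])
qed

lemmas grad_rho = Ck_on_has_grad[OF Ck_on_rho[unfolded numeral_2_eq_2]]

text \<open>Differentiating \<open>\<phi>\<^sub>X\<^sub>T = 1 - 1 / \<rho>\<close> in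
  \<open>T\<close> gives \<open>u\<^sub>X = \<rho>\<^sub>T / \<rho>\<^sup>2\<close>, because
  \<open>\<phi>\<^sub>X\<^sub>T\<^sub>T = u\<^sub>X\<close>.\<close>

lemma pd_rho_T:
  assumes p: "p \<in> U"
  shows "pd2 \<rho> p = (\<rho> p)\<^sup>2 * pd1 u p"
proof -
  have "pd2 (pd1 (pd2 \<phi>)) p = pd1 (pd2 (pd2 \<phi>)) p"
    by (rule pd_commute[OF U p Ck_on_le[OF Ck_on_phi_pd(2)], symmetric]) simp
  also have "\<dots> = pd1 u p"
    by (rule pd_cong(1)[OF U p u[symmetric]])
  finally have "pd2 (\<lambda>q. pd1 (pd2 \<phi>) q) p = pd1 u p" .
  moreover have "pd2 (\<lambda>q. pd1 (pd2 \<phi>) q) p = pd2 (\<lambda>q. 1 - 1 / \<rho> q) p"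
    by (rule pd_cong(2)[OF U p pd_phi_XT])
  moreover have "has_grad (\<lambda>q. 1 - 1 / \<rho> q) (1 / (\<rho> p)\<^sup>2 * pd1 \<rho> p) (1 / (\<rho> p)\<^sup>2 * pd2 \<rho> p) p"
    by (rule has_grad_DERIV_compose[OF grad_rho[OF p]])
      (use rho_nonzero[OF p] in \<open>auto intro!: derivative_eq_intros simp: power2_eq_square\<close>)
  ultimately have "1 / (\<rho> p)\<^sup>2 * pd2 \<rho> p = pd1 u p"
    using has_grad_pd2 by metis
  then show ?thesis
    using rho_nonzero[OF p] by (simp add: field_simps)
qed

text \<open>In terms of \<open>\<psi> = g / f\<close> this says \<open>\<psi>\<^sub>T = (c \<rho> - c - \<rho> u\<^sub>X) / 2 \<cdot> \<psi>\<close>.\<close>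

lemma pd_g_T:
  assumes p: "p \<in> U"
  shows "pd2 g p = ((c * \<rho> p - c - \<rho> p * pd1 u p) / 2 + pd2 \<phi> p) * g p"
proof -
  have f3: "Ck_on 3 U f"
    by (rule Ck_on_le[OF f]) simp
  note E = bilinear_eqs_imp[OF U f3 g bilinear p]
  note F = pd_exp_log[OF U f3 f_pos p, folded \<phi>]
  have uX: "pd1 (pd2 (pd2 \<phi>)) p = pd1 u p"
    by (rule pd_cong(1)[OF U p u[symmetric]])
  \<comment> \<open>By \<open>F\<close> every derivative of \<open>f\<close> is a multiple of
    \<open>f p\<close>, which factors out and, being positive, cancels.\<close>
  have "f p * (pd2 (pd2 g) p - 2 * pd2 g p * pd2 \<phi> p + g p * (u p + (pd2 \<phi> p)\<^sup>2)
      + c * (pd2 g p - g p * pd2 \<phi> p)) = 0"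
    using E(1) unfolding F u[OF p, symmetric] by (simp add: algebra_simps)
  then have E1: "pd2 (pd2 g) p - 2 * pd2 g p * pd2 \<phi> p + g p * (u p + (pd2 \<phi> p)\<^sup>2)
      + c * (pd2 g p - g p * pd2 \<phi> p) = 0"
    using pos[OF p] by simp
  define m where "m = pd1 (pd2 \<phi>) p"
  have "f p * (pd2 (pd2 g) p * pd1 \<phi> p - 2 * pd2 g p * (m + pd1 \<phi> p * pd2 \<phi> p)
      + g p * (pd1 u p + 2 * pd2 \<phi> p * m + pd1 \<phi> p * (u p + (pd2 \<phi> p)\<^sup>2))
      + c * (pd2 g p * pd1 \<phi> p - g p * (m + pd1 \<phi> p * pd2 \<phi> p))
      + 2 * (pd2 g p - g p * pd2 \<phi> p)) = 0"
    using E(2) unfolding F u[OF p, symmetric] uX m_def[symmetric] by (simp add: algebra_simps)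
  then have E2: "pd2 (pd2 g) p * pd1 \<phi> p - 2 * pd2 g p * (m + pd1 \<phi> p * pd2 \<phi> p)
      + g p * (pd1 u p + 2 * pd2 \<phi> p * m + pd1 \<phi> p * (u p + (pd2 \<phi> p)\<^sup>2))
      + c * (pd2 g p * pd1 \<phi> p - g p * (m + pd1 \<phi> p * pd2 \<phi> p))
      + 2 * (pd2 g p - g p * pd2 \<phi> p) = 0"
    using pos[OF p] by simp
  \<comment> \<open>This is \<open>E2\<close> minus \<open>pd1 \<phi> p\<close> times
    \<open>E1\<close>, which removes the second derivative of \<open>g\<close>. The factor
    \<open>1 - m\<close> is \<open>1 / \<rho> p\<close>.\<close>
  have "2 * (1 - m) * (pd2 g p - g p * pd2 \<phi> p) = (c * m - pd1 u p) * g p"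
    using E1 E2 by algebra
  moreover have "m = 1 - 1 / \<rho> p"
    by (simp add: m_def pd_phi_XT p)
  ultimately show ?thesis
    using rho_nonzero[OF p] by (simp add: field_simps)
qed

lemma Ck_on_rho_uX: "Ck_on 1 U (\<lambda>q. \<rho> q * pd1 u q)"
  using Ck_on_u by (intro Ck_on_mult U Ck_on_le[OF Ck_on_rho]) (simp_all add: numeral_2_eq_2)

text \<open>The \<open>T\<close>-derivative of the first-order equation for \<open>g\<close>,
  inserted into the first bilinear equation, yields the claim multiplied by \<open>g\<close>. The
  factor \<open>g\<close> is then removed by continuity and density.\<close>

lemma pd_rho_uX_T:
  assumes dense: "interior {p \<in> U. g p = 0} = {}" and p: "p \<in> U"
  shows "pd2 (\<lambda>q. \<rho> q * pd1 u q) p =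
    c\<^sup>2 / 2 * (\<rho> p)\<^sup>2 + (\<rho> p * pd1 u p)\<^sup>2 / 2 - c\<^sup>2 / 2 + 4 * u p"
proof -
  define w where "w = (\<lambda>q. \<rho> q * pd1 u q)"
  \<comment> \<open>\<open>Q\<close> is the right side of the claim minus the left side.\<close>
  define Q where "Q = (\<lambda>q. c\<^sup>2 / 2 * (\<rho> q)\<^sup>2 + (w q)\<^sup>2 / 2 - c\<^sup>2 / 2 + 4 * u q - pd2 w q)"
  have w: "Ck_on 1 U w"
    unfolding w_def by (rule Ck_on_rho_uX)
  have f3: "Ck_on 3 U f"
    by (rule Ck_on_le[OF f]) simp
  have Qg: "Q q * g q = 0" if q: "q \<in> U" for q
  proof -
    \<comment> \<open>\<open>A\<close> is the coefficient in
      \<open>\<psi>\<^sub>T = A \<psi>\<close>, so that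
      \<open>g\<^sub>T = (A + \<phi>\<^sub>T) g\<close>.\<close>
    define A where "A = (\<lambda>q. c / 2 * \<rho> q - c / 2 - 1 / 2 * w q)"
    have gT: "pd2 g r = (A r + pd2 \<phi> r) * g r" if "r \<in> U" for r
      using pd_g_T[OF that] by (simp add: A_def w_def field_simps)
    have grad_g: "has_grad g (pd1 g q) (pd2 g q) q"
      using g q by (simp add: numeral_3_eq_3 differentiable_has_grad)
    have grad_\<phi>: "has_grad (pd2 \<phi>) (pd1 (pd2 \<phi>) q) (pd2 (pd2 \<phi>) q) q"
      using Ck_on_phi_pd(2) q by (simp add: numeral_3_eq_3 differentiable_has_grad)
    have grad_w: "has_grad w (pd1 w q) (pd2 w q) q"
      using w q by (simp add: differentiable_has_grad)
    have "has_grad (pd2 g)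
        (((0 * \<rho> q + c / 2 * pd1 \<rho> q - 0 - (0 * w q + 1 / 2 * pd1 w q)) + pd1 (pd2 \<phi>) q) * g q
          + (A q + pd2 \<phi> q) * pd1 g q)
        (((0 * \<rho> q + c / 2 * pd2 \<rho> q - 0 - (0 * w q + 1 / 2 * pd2 w q)) + pd2 (pd2 \<phi>) q) * g q
          + (A q + pd2 \<phi> q) * pd2 g q) q"
      unfolding A_def
      by (rule has_grad_cong[OF U q gT[symmetric, unfolded A_def]], assumption)
        (intro has_grad_mult has_grad_add has_grad_diff has_grad_const grad_rho grad_w grad_\<phi> grad_g q)+
    from has_grad_pd2[OF this]
    have gTT: "pd2 (pd2 g) q = (c / 2 * pd2 \<rho> q - 1 / 2 * pd2 w q + u q) * g q
          + (A q + pd2 \<phi> q) * pd2 g q"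
      using q by (simp add: u)
    note F = pd_exp_log[OF U f3 f_pos q, folded \<phi>]
    have "f q * (pd2 (pd2 g) q - 2 * pd2 g q * pd2 \<phi> q + g q * (u q + (pd2 \<phi> q)\<^sup>2)
        + c * (pd2 g q - g q * pd2 \<phi> q)) = 0"
      using bilinear_eqs_imp(1)[OF U f3 g bilinear q]
      unfolding F u[OF q, symmetric] by (simp add: algebra_simps)
    then have E: "pd2 (pd2 g) q - 2 * pd2 g q * pd2 \<phi> q + g q * (u q + (pd2 \<phi> q)\<^sup>2)
        + c * (pd2 g q - g q * pd2 \<phi> q) = 0"
      using pos[OF q] by simp
    have \<rho>T: "pd2 \<rho> q = \<rho> q * w q"
      using pd_rho_T[OF q] by (simp add: w_def power2_eq_square)
    have "2 * (c / 2 * pd2 \<rho> q - 1 / 2 * pd2 w q + 2 * u q + (A q)\<^sup>2 + c * A q) * g q = 0"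
      using E unfolding gTT gT[OF q] by algebra
    \<comment> \<open>Here
      \<open>A\<^sup>2 + c A = ((c \<rho> - w)\<^sup>2 - c\<^sup>2) / 4\<close>, and twice its cross
      term cancels against \<open>c \<rho>\<^sub>T = c \<rho> w\<close>.\<close>
    also have "2 * (c / 2 * pd2 \<rho> q - 1 / 2 * pd2 w q + 2 * u q + (A q)\<^sup>2 + c * A q) = Q q"
      by (simp add: \<rho>T Q_def A_def power2_eq_square field_simps)
    finally show ?thesis .
  qed
  have "continuous_on U (pd2 w)"
    using w by simp
  then have "continuous_on U Q"
    unfolding Q_def
    by (intro continuous_intros Ck_on_rho[THEN Ck_on_continuous_on] w[THEN Ck_on_continuous_on]
      Ck_on_u[THEN Ck_on_continuous_on]) simp
  \<comment> \<open>The set where \<open>Q\<close> is nonzero is open and lies in the zero set of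
    \<open>g\<close>, which has empty interior.\<close>
  then have "open (U \<inter> Q -` (- {0}))"
    by (rule continuous_open_preimage[OF _ U]) (simp add: open_Compl)
  moreover have "U \<inter> Q -` (- {0}) \<subseteq> {p \<in> U. g p = 0}"
    using Qg by auto
  ultimately have "U \<inter> Q -` (- {0}) = {}"
    using dense interior_maximal by blast
  with p have "Q p = 0" by blast
  then show ?thesis
    by (simp add: Q_def w_def)
qed

section \<open>The hodograph transformation\<close>

text \<open>\<open>dX / \<rho> - u dT\<close> is the differential of \<open>X - (log f)\<^sub>T\<close>.\<close>

lemma ex_hodograph:
  assumes p: "p \<in> U"
  shows "\<exists>V W H. p \<in> W \<and> W \<subseteq> U \<and> hodograph u \<rho> V W H"
proof -
  \<comment> \<open>Constant matrix units as bounded linear maps: continuity of a Jacobian in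
    operator norm reduces to that of its coefficients.\<close>
  define L1 where "L1 = Blinfun (\<lambda>(h :: real, k :: real). (h, 0 :: real))"
  define L2 where "L2 = Blinfun (\<lambda>(h :: real, k :: real). (k, 0 :: real))"
  define L3 where "L3 = Blinfun (\<lambda>(h :: real, k :: real). (0 :: real, k))"
  have "bounded_linear (\<lambda>(h :: real, k :: real). (h, 0 :: real))"
    "bounded_linear (\<lambda>(h :: real, k :: real). (k, 0 :: real))"
    "bounded_linear (\<lambda>(h :: real, k :: real). (0 :: real, k))"
    unfolding case_prod_beta
    by (intro bounded_linear_Pair bounded_linear_fst bounded_linear_snd bounded_linear_zero)+
  then have L: "blinfun_apply L1 (h, k) = (h, 0)" "blinfun_apply L2 (h, k) = (k, 0)"
    "blinfun_apply L3 (h, k) = (0, k)" for h k :: real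
    by (simp_all add: L1_def L2_def L3_def bounded_linear_Blinfun_apply)
  \<comment> \<open>\<open>G\<close> sends \<open>(X, T)\<close> to \<open>(x, t)\<close> with
    \<open>x = X - \<phi>\<^sub>T\<close>. \<open>G'\<close> is its Jacobian, and \<open>N\<close>
    is the inverse matrix, the Jacobian prescribed for the hodograph map.\<close>
  define G where "G = (\<lambda>q :: real \<times> real. (fst q - pd2 \<phi> q, snd q))"
  define G' where "G' = (\<lambda>q. (1 / \<rho> q) *\<^sub>R L1 - u q *\<^sub>R L2 + L3)"
  define N where "N q = (\<rho> q *\<^sub>R L1 + (\<rho> q * u q) *\<^sub>R L2 + L3)" for q
  have G'_apply: "blinfun_apply (G' q) (h, k) = (h / \<rho> q - u q * k, k)" for q h k
    by (simp add: G'_def L blinfun.bilinear_simps)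
  have N_apply: "blinfun_apply (N q) (h, k) = (\<rho> q * h + \<rho> q * u q * k, k)" for q h k
    by (simp add: N_def L blinfun.bilinear_simps)
  have der: "(G has_derivative blinfun_apply (G' q)) (at q)" if q: "q \<in> U" for q
  proof -
    have "has_grad (pd2 \<phi>) (1 - 1 / \<rho> q) (u q) q"
      using Ck_on_phi_pd(2) q pd_phi_XT[OF q] u[OF q] differentiable_has_grad[of "pd2 \<phi>" q]
      by (simp add: numeral_3_eq_3)
    then have "(pd2 \<phi> has_derivative (\<lambda>(h, k). (1 - 1 / \<rho> q) * h + u q * k)) (at q)"
      by (simp add: has_grad_def)
    then have "(G has_derivative
        (\<lambda>v. (fst v - (\<lambda>(h, k). (1 - 1 / \<rho> q) * h + u q * k) v, snd v))) (at q)"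
      unfolding G_def by (auto intro!: derivative_eq_intros)
    moreover have "(\<lambda>v. (fst v - (\<lambda>(h, k). (1 - 1 / \<rho> q) * h + u q * k) v, snd v)) =
        blinfun_apply (G' q)"
      by (rule ext) (auto simp: G'_apply algebra_simps)
    ultimately show ?thesis by simp
  qed
  have cont: "continuous_on U G'"
    unfolding G'_def using rho_nonzero
    by (intro continuous_intros Ck_on_continuous_on[OF Ck_on_rho] Ck_on_continuous_on[OF Ck_on_u]) auto
  have inv: "N p o\<^sub>L G' p = id_blinfun"
    using rho_nonzero[OF p]
    by (intro blinfun_eqI) (auto simp: G'_apply N_apply algebra_simps)
  obtain W V H H' where W: "open W" "W \<subseteq> U" "p \<in> W" and V: "open V"
    and hom: "homeomorphism W V G H"
    and H: "\<And>y. y \<in> V \<Longrightarrow> (H has_derivative (H' y)) (at y)"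
    and H': "\<And>y. y \<in> V \<Longrightarrow> H' y = Hilbert_Choice.inv (blinfun_apply (G' (H y)))"
    using inverse_function_theorem[OF U der cont p inv] by metis
  have bij: "bij_betw H V W"
    using hom by (auto simp: homeomorphism_def bij_betw_def intro: inj_on_inverseI)
  have "(H has_derivative (\<lambda>(h, k). (\<rho> (H y) * h + \<rho> (H y) * u (H y) * k, k))) (at y)"
    if y: "y \<in> V" for y
  proof -
    have "H y \<in> U"
      using bij y W(2) by (auto simp: bij_betw_def)
    \<comment> \<open>The inverse function theorem gives the derivative of \<open>H\<close> as an
      abstract inverse; here it is identified with \<open>N\<close>.\<close>
    then have "Hilbert_Choice.inv (blinfun_apply (G' (H y))) = blinfun_apply (N (H y))"
      by (intro inv_equality)
        (use rho_nonzero[of "H y"] in \<open>auto simp: G'_apply N_apply field_simps\<close>)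
    also have "\<dots> = (\<lambda>(h, k). (\<rho> (H y) * h + \<rho> (H y) * u (H y) * k, k))"
      by (auto simp: N_apply)
    finally show ?thesis
      using H[OF y] H'[OF y] by simp
  qed
  with W V bij show ?thesis
    unfolding hodograph_def by blast
qed

end

section \<open>Chain rule and regularity along the hodograph map\<close>

lemma hodograph_in: "hodograph u \<rho> V W H \<Longrightarrow> p \<in> V \<Longrightarrow> H p \<in> W"
  by (auto simp: hodograph_def bij_betw_def)

text \<open>The chain rule in the form \<open>\<partial>\<^sub>x = \<rho> \<partial>\<^sub>X\<close>
  and \<open>\<partial>\<^sub>t = \<partial>\<^sub>T + \<rho> u \<partial>\<^sub>X\<close>.\<close>

lemma hodograph_has_grad:
  assumes "hodograph u \<rho> V W H" "p \<in> V" "has_grad F a b (H p)"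
  shows "has_grad (F \<circ> H) (a * \<rho> (H p)) (a * (\<rho> (H p) * u (H p)) + b) p"
proof -
  have "((\<lambda>q. F (H q)) has_derivative
      (\<lambda>v. (\<lambda>(h, k). a * h + b * k)
        ((\<lambda>(h, k). (\<rho> (H p) * h + \<rho> (H p) * u (H p) * k, k)) v))) (at p)"
    using assms by (intro has_derivative_compose[where f = H and g = F])
      (auto simp: hodograph_def has_grad_def)
  then show ?thesis
    by (simp add: has_grad_def case_prod_unfold algebra_simps comp_def)
qed

text \<open>Partial derivatives of \<open>F \<circ> H\<close> are again compositions with
  \<open>H\<close>, of expressions in \<open>u\<close>, \<rho> and the gradient of \<open>F\<close>;
  hence the induction over arbitrary \<open>F\<close>.\<close>

lemma Ck_on_hodograph:
  assumes hod: "hodograph u \<rho> V W H" and "Ck_on k W u" "Ck_on k W \<rho>" "Ck_on k W F"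
  shows "Ck_on k V (F \<circ> H)"
  using assms(2-)
proof (induction k arbitrary: F)
  case 0
  have "continuous_on V H"
    using hod by (intro continuous_at_imp_continuous_on)
      (auto simp: hodograph_def intro: has_derivative_continuous)
  moreover have "H ` V = W"
    using hod by (auto simp: hodograph_def bij_betw_def)
  ultimately show ?case
    using 0(3) continuous_on_compose[of V H F] by simp
next
  case (Suc k)
  have V: "open V" and W: "open W"
    using hod by (auto simp: hodograph_def)
  note C = Suc.prems(1,2)[THEN Ck_on_SucD] Ck_on_pd[OF Suc.prems(3)]
  show ?case
  proof (rule Ck_on_SucI[OF V])
    show "has_grad (F \<circ> H) (((\<lambda>q. pd1 F q * \<rho> q) \<circ> H) p)
        (((\<lambda>q. pd1 F q * (\<rho> q * u q) + pd2 F q) \<circ> H) p) p" if "p \<in> V" for p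
      using hodograph_has_grad[OF hod that Ck_on_has_grad[OF Suc.prems(3) hodograph_in[OF hod that]]]
      by simp
    show "Ck_on k V ((\<lambda>q. pd1 F q * \<rho> q) \<circ> H)"
      "Ck_on k V ((\<lambda>q. pd1 F q * (\<rho> q * u q) + pd2 F q) \<circ> H)"
      by (intro Suc.IH C Ck_on_add Ck_on_mult W)+
  qed
qed

text \<open>With \<open>w = \<rho> u\<^sub>X = u\<^sub>x\<close> and \<open>\<partial>\<^sub>T =
  \<partial>\<^sub>t - u \<partial>\<^sub>x\<close>, the combination
  \<open>u\<^sub>t\<^sub>x - u u\<^sub>x\<^sub>x\<close> is \<open>w\<^sub>T\<close>, so
  \<open>wT\<close> is the first equation. The second one is \<open>\<rho>T\<close>, as
  \<open>\<rho> u \<rho>\<^sub>X\<close> occurs on both sides.\<close>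

lemma two_HS_hodograph:
  assumes hod: "hodograph u \<rho> V W H"
    and u: "Ck_on 2 W u" and \<rho>: "Ck_on 2 W \<rho>"
    and \<rho>T: "\<And>q. q \<in> W \<Longrightarrow> pd2 \<rho> q = (\<rho> q)\<^sup>2 * pd1 u q"
    and wT: "\<And>q. q \<in> W \<Longrightarrow> pd2 (\<lambda>q. \<rho> q * pd1 u q) q =
      c\<^sup>2 / 2 * (\<rho> q)\<^sup>2 + (\<rho> q * pd1 u q)\<^sup>2 / 2 - c\<^sup>2 / 2 + 4 * u q"
  shows "two_HS c V (u \<circ> H) (\<rho> \<circ> H)"
  unfolding two_HS_def
proof (intro conjI ballI)
  have V: "open V" and W: "open W"
    using hod by (auto simp: hodograph_def)
  show "Ck_on 2 V (u \<circ> H)"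
    by (rule Ck_on_hodograph[OF hod u \<rho> u])
  have "Ck_on 2 V (\<rho> \<circ> H)"
    by (rule Ck_on_hodograph[OF hod u \<rho> \<rho>])
  then show "Ck_on 1 V (\<rho> \<circ> H)"
    by (rule Ck_on_le) simp
  fix p assume p: "p \<in> V"
  define q where "q = H p"
  have q: "q \<in> W"
    unfolding q_def by (rule hodograph_in[OF hod p])
  have grad: "has_grad F (pd1 F r) (pd2 F r) r" if "Ck_on 2 W F" "r \<in> W" for F r
    using that by (simp add: numeral_2_eq_2 differentiable_has_grad)
  have grad_uX: "has_grad (pd1 u) (pd1 (pd1 u) q) (pd2 (pd1 u) q) q"
    and grad_uT: "has_grad (pd2 u) (pd1 (pd2 u) q) (pd2 (pd2 u) q) q"
    using u q by (simp_all add: numeral_2_eq_2 differentiable_has_grad)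
  define w where "w = (\<lambda>q. \<rho> q * pd1 u q)"
  have grad_w: "has_grad w (pd1 \<rho> q * pd1 u q + \<rho> q * pd1 (pd1 u) q)
      (pd2 \<rho> q * pd1 u q + \<rho> q * pd2 (pd1 u) q) q"
    unfolding w_def by (rule has_grad_mult[OF grad[OF \<rho> q] grad_uX])
  have grad_uH: "has_grad (u \<circ> H) (w (H r)) (w (H r) * u (H r) + pd2 u (H r)) r" if "r \<in> V" for r
    using hodograph_has_grad[OF hod that grad[OF u hodograph_in[OF hod that]]]
    by (simp add: w_def mult_ac)
  have ux: "pd1 (u \<circ> H) r = (w \<circ> H) r" if "r \<in> V" for r
    using has_grad_pd1[OF grad_uH[OF that]] by simp
  have ut: "pd2 (u \<circ> H) r = ((\<lambda>q. w q * u q + pd2 u q) \<circ> H) r" if "r \<in> V" for r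
    using has_grad_pd2[OF grad_uH[OF that]] by simp
  have uxx: "pd1 (pd1 (u \<circ> H)) p = (pd1 \<rho> q * pd1 u q + \<rho> q * pd1 (pd1 u) q) * \<rho> q"
    using pd_cong(1)[OF V p, of "pd1 (u \<circ> H)" "w \<circ> H", OF ux]
      has_grad_pd1[OF hodograph_has_grad[OF hod p grad_w[unfolded q_def]]]
    by (simp add: q_def)
  have utx: "pd1 (pd2 (u \<circ> H)) p = ((pd1 \<rho> q * pd1 u q + \<rho> q * pd1 (pd1 u) q) * u q
      + w q * pd1 u q + pd1 (pd2 u) q) * \<rho> q"
    using pd_cong(1)[OF V p, of "pd2 (u \<circ> H)" "(\<lambda>q. w q * u q + pd2 u q) \<circ> H", OF ut]
      has_grad_pd1[OF hodograph_has_grad[OF hod p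
      has_grad_add[OF has_grad_mult[OF grad_w grad[OF u q]] grad_uT, unfolded q_def]]]
    by (simp add: q_def)
  have "pd2 w q = pd2 \<rho> q * pd1 u q + \<rho> q * pd2 (pd1 u) q"
    by (rule has_grad_pd2[OF grad_w])
  with \<rho>T[OF q] pd_commute[OF W q u]
  have "pd2 w q = w q * w q + \<rho> q * pd1 (pd2 u) q"
    by (simp add: w_def power2_eq_square)
  with wT[OF q, folded w_def]
  have *: "w q * w q + \<rho> q * pd1 (pd2 u) q =
      c\<^sup>2 / 2 * (\<rho> q)\<^sup>2 + (w q)\<^sup>2 / 2 - c\<^sup>2 / 2 + 4 * u q"
    by (simp add: w_def)
  \<comment> \<open>The terms with derivatives of \<rho> and with \<open>u\<^sub>X\<^sub>X\<close>
    cancel; what remains equals \<open>pd2 w q\<close>.\<close>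
  have "pd1 (pd2 (u \<circ> H)) p - u q * pd1 (pd1 (u \<circ> H)) p = w q * w q + \<rho> q * pd1 (pd2 u) q"
    unfolding utx uxx by (simp add: w_def algebra_simps)
  then show "pd1 (pd2 (u \<circ> H)) p - (u \<circ> H) p * pd1 (pd1 (u \<circ> H)) p
      - 1/2 * (pd1 (u \<circ> H) p)\<^sup>2 - 4 * (u \<circ> H) p - c\<^sup>2 / 2 * ((\<rho> \<circ> H) p)\<^sup>2 + c\<^sup>2 / 2 = 0"
    using * ux[OF p] by (simp add: q_def)
  have "pd2 (\<rho> \<circ> H) p = pd1 \<rho> q * (\<rho> q * u q) + pd2 \<rho> q"
    using has_grad_pd2[OF hodograph_has_grad[OF hod p grad[OF \<rho> q, unfolded q_def]]]
    by (simp add: q_def)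
  moreover have "pd1 ((\<lambda>r. \<rho> r * u r) \<circ> H) p = (pd1 \<rho> q * u q + \<rho> q * pd1 u q) * \<rho> q"
    using has_grad_pd1[OF hodograph_has_grad[OF hod p
      has_grad_mult[OF grad[OF \<rho> q] grad[OF u q], unfolded q_def]]]
    by (simp add: q_def)
  ultimately show "pd2 (\<rho> \<circ> H) p = pd1 (\<lambda>q. (\<rho> \<circ> H) q * (u \<circ> H) q) p"
    using \<rho>T[OF q] by (simp add: comp_def power2_eq_square algebra_simps)
qed

text \<open>Local existence of hodograph maps keeps the universal statement from being vacuous; that
  statement covers every such map, not only the one built from
  \<open>X - \<phi>\<^sub>T\<close>.\<close>

theorem theorem1:
  fixes c :: real and U :: "(real \<times> real) set"
    and f g \<psi> u \<rho> :: "real \<times> real \<Rightarrow> real"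
  assumes "c > 0"
    and "open U"
    and "Ck_on 4 U f" and "Ck_on 3 U g"
    and "\<And>p. p \<in> U \<Longrightarrow> f p > 0"
    and "bilinear_eqs c U g f"
    and "\<And>p. p \<in> U \<Longrightarrow> \<psi> p = g p / f p"
    and "\<And>p. p \<in> U \<Longrightarrow> u p = pd2 (pd2 (\<lambda>q. ln (f q))) p"
    and "\<And>p. p \<in> U \<Longrightarrow> \<rho> p = 1 / (1 - pd2 (pd1 (\<lambda>q. ln (f q))) p)"
    and "\<And>p. p \<in> U \<Longrightarrow> 1 - pd2 (pd1 (\<lambda>q. ln (f q))) p \<noteq> 0"
    and "interior {p \<in> U. \<psi> p = 0} = {}"
  shows "(\<forall>p\<in>U. \<exists>V W H. p \<in> W \<and> W \<subseteq> U \<and> hodograph u \<rho> V W H) \<and>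
    (\<forall>V W H. W \<subseteq> U \<and> hodograph u \<rho> V W H \<longrightarrow> two_HS c V (u \<circ> H) (\<rho> \<circ> H))"
proof (intro conjI ballI allI impI; (elim conjE)?)
  \<comment> \<open>\<open>refl\<close> instantiates \<phi> as the logarithm of
    \<open>f\<close>.\<close>
  note hyps = assms(2-6) refl assms(8-10)
  show "\<exists>V W H. p \<in> W \<and> W \<subseteq> U \<and> hodograph u \<rho> V W H" if "p \<in> U" for p
    by (rule ex_hodograph[OF hyps that])
  \<comment> \<open>As \<open>f\<close> is positive on \<open>U\<close>, \<psi> and \<open>g\<close>
    have the same zeros there.\<close>
  have "{p \<in> U. \<psi> p = 0} = {p \<in> U. g p = 0}"
    using assms(5,7) by fastforce
  with assms(11) have dense: "interior {p \<in> U. g p = 0} = {}"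
    by simp
  fix V W H assume "W \<subseteq> U" and hod: "hodograph u \<rho> V W H"
  then have W: "q \<in> U" if "q \<in> W" for q
    using that by blast
  show "two_HS c V (u \<circ> H) (\<rho> \<circ> H)"
    by (rule two_HS_hodograph[OF hod])
      (use Ck_on_subset[OF Ck_on_u[OF hyps] \<open>W \<subseteq> U\<close>] Ck_on_subset[OF Ck_on_rho[OF hyps] \<open>W \<subseteq> U\<close>]
        pd_rho_T[OF hyps W] pd_rho_uX_T[OF hyps dense W] in auto)
qed

end
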